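(* Let $V\in\tilde{\mathcal V}^+\cup\tilde{\mathcal V}^-$. Then for every $\mathbf x_0\in S$ the following statements hold: (i) if $\omega_V(\mathbf x_0)\neq\emptyset$, then $\omega_V(\mathbf x_0)$ either consists of exactly one point or is infinite; (ii) $\omega_V^{(w)}(\mathbf x_0)$ either consists of exactly one point or is infinite.
   Context: $\ell^1$ is the space of absolutely summable real sequences $\mathbf x=(x_k)_{k\ge1}$ with norm $\|\mathbf x\|=\sum_k|x_k|$, and $S=\{\mathbf x\in\ell^1: x_k\ge0\ \text{for all }k,\ \|\mathbf x\|=1\}$. A Volterra operator is a map $V:S\to S$ of the form $(V(\mathbf x))_k=x_k\left(1+\sum_{i=1}^\infty a_{ki}x_i\right)$, $k\in\mathbb N$, where $(a_{ki})_{k,i\in\mathbb N}$ is a real matrix with $a_{ki}=-a_{ik}$ and $|a_{ki}|\le1$ for all $k,i$; this matrix is uniquely determined by $V$. $V\in\tilde{\mathcal V}^+$ (resp. $V\in\tilde{\mathcal V}^-$) means that $V$ is a Volterra operator and there is an integer $k_0\ge1$ such that $a_{ki}=0$ whenever $k<k_0\le i$, and $a_{ki}\ge0$ (resp. $a_{ki}\le0$) whenever $k_0\le k<i$. Equivalently, the matrix is block diagonal with an arbitrary admissible skew-symmetric $(k_0-1)\times(k_0-1)$ block and an infinite block whose entries above the diagonal are all $\ge0$ (resp. all $\le 0$). For $\mathbf x_0\in S$, $\omega_V(\mathbf x_0)$ is the set of all limits, in $\ell^1$-norm, of subsequences $V^{n_j}(\mathbf x_0)$ ($n_j\to\infty$)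 of the trajectory $\{V^n(\mathbf x_0)\}$, where $V^n$ is the $n$-th iterate; $\omega_V^{(w)}(\mathbf x_0)$ is the set of all limits of such subsequences with respect to pointwise (coordinatewise) convergence in the space of all real sequences. *)

theory Defs
  imports "HOL-Analysis.Analysis"
begin

text \<open>
  Sequences are functions on \<^typ>\<open>nat\<close>: the coordinate written \<open>x\<^sub>k\<close> for \<open>k \<ge> 1\<close> in the
  literature is \<open>x (k - 1)\<close> here, and likewise for the indices of matrices.
\<close>

definition ell1 :: "(nat \<Rightarrow> real) set" where
  "ell1 = {x. summable (\<lambda>k. \<bar>x k\<bar>)}"

definition ell1_norm :: "(nat \<Rightarrow> real) \<Rightarrow> real" where
  "ell1_norm x = (\<Sum>k. \<bar>x k\<bar>)"

definition inf_simplex :: "(nat \<Rightarrow> real) set" where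
  "inf_simplex = {x \<in> ell1. (\<forall>k. 0 \<le> x k) \<and> ell1_norm x = 1}"

definition volterra_matrix :: "(nat \<Rightarrow> nat \<Rightarrow> real) \<Rightarrow> bool" where
  "volterra_matrix a \<longleftrightarrow> (\<forall>k i. a k i = - a i k \<and> \<bar>a k i\<bar> \<le> 1)"

text \<open>Only the values of \<open>V\<close> on the simplex are constrained; \<open>V\<close> is arbitrary elsewhere.\<close>

definition volterra_operator ::
  "((nat \<Rightarrow> real) \<Rightarrow> (nat \<Rightarrow> real)) \<Rightarrow> (nat \<Rightarrow> nat \<Rightarrow> real) \<Rightarrow> bool" where
  "volterra_operator V a \<longleftrightarrow>
     V \<in> inf_simplex \<rightarrow> inf_simplex \<and> volterra_matrix a \<and>
     (\<forall>x \<in> inf_simplex. \<forall>k. V x k = x k * (1 + (\<Sum>i. a k i * x i)))"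

text \<open>
  Because indices start at 0, the number \<open>m\<close> below is the size of the finite block; it
  corresponds to \<open>k\<^sub>0 = m + 1\<close> for the integer \<open>k\<^sub>0 \<ge> 1\<close> of the 1-based convention.
  The matrix \<open>a\<close> is uniquely determined by \<open>V\<close>, so quantifying over it is harmless.
\<close>

definition Volterra_plus :: "((nat \<Rightarrow> real) \<Rightarrow> (nat \<Rightarrow> real)) set" where
  "Volterra_plus = {V. \<exists>a. volterra_operator V a \<and>
     (\<exists>m. (\<forall>k i. k < m \<and> m \<le> i \<longrightarrow> a k i = 0) \<and>
          (\<forall>k i. m \<le> k \<and> k < i \<longrightarrow> 0 \<le> a k i))}"

definition Volterra_minus :: "((nat \<Rightarrow> real) \<Rightarrow> (nat \<Rightarrow> real)) set" where
  "Volterra_minus = {V. \<exists>a. volterra_operator V a \<and>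
     (\<exists>m. (\<forall>k i. k < m \<and> m \<le> i \<longrightarrow> a k i = 0) \<and>
          (\<forall>k i. m \<le> k \<and> k < i \<longrightarrow> a k i \<le> 0))}"

text \<open>
  Membership in \<^const>\<open>ell1\<close> is required explicitly for the sequence and its limit,
  since \<^const>\<open>ell1_norm\<close> is meaningless on sequences that are not absolutely summable.
\<close>

definition ell1_tendsto :: "(nat \<Rightarrow> nat \<Rightarrow> real) \<Rightarrow> (nat \<Rightarrow> real) \<Rightarrow> bool" where
  "ell1_tendsto u y \<longleftrightarrow> y \<in> ell1 \<and> (\<forall>j. u j \<in> ell1) \<and>
     (\<lambda>j. ell1_norm (\<lambda>k. u j k - y k)) \<longlonglongrightarrow> 0"

definition pointwise_tendsto :: "(nat \<Rightarrow> nat \<Rightarrow> real) \<Rightarrow> (nat \<Rightarrow> real) \<Rightarrow> bool" where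
  "pointwise_tendsto u y \<longleftrightarrow> (\<forall>k. (\<lambda>j. u j k) \<longlonglongrightarrow> y k)"

definition omega_limit ::
  "((nat \<Rightarrow> real) \<Rightarrow> (nat \<Rightarrow> real)) \<Rightarrow> (nat \<Rightarrow> real) \<Rightarrow> (nat \<Rightarrow> real) set" where
  "omega_limit V x0 = {y. \<exists>n :: nat \<Rightarrow> nat. strict_mono n \<and>
     ell1_tendsto (\<lambda>j. (V ^^ n j) x0) y}"

definition omega_limit_weak ::
  "((nat \<Rightarrow> real) \<Rightarrow> (nat \<Rightarrow> real)) \<Rightarrow> (nat \<Rightarrow> real) \<Rightarrow> (nat \<Rightarrow> real) set" where
  "omega_limit_weak V x0 = {y. \<exists>n :: nat \<Rightarrow> nat. strict_mono n \<and>
     pointwise_tendsto (\<lambda>j. (V ^^ n j) x0) y}"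

end

theory Submission
  imports Defs
begin

text \<open>
  Let the finite block consist of the first \<open>m\<close> coordinates. The two blocks do not interact, and
  they behave differently.

  On the infinite block every coordinate converges. By skew-symmetry the mass
  \<open>x\<^sub>0 + \<dots> + x\<^bsub>N-1\<^esub>\<close> changes in one step only by the flow between indices below \<open>N\<close> and indices
  from \<open>N\<close> on, and for \<open>N \<ge> m\<close> this flow always has the same direction, because all entries above
  the diagonal have one sign. So these partial sums are monotone and bounded along the trajectory
  (\<open>partial_sum_convergent\<close>), and the coordinates with index \<open>k \<ge> m\<close>, being differences of
  two such sums, converge (\<open>tail_coord_convergent\<close>).

  The finite block evolves autonomously under a continuous map \<open>W\<close>, and its trajectory is bounded.
  If a precompact trajectory of a continuous map has a finite limit set, then this set contains a
  periodic point; if moreover periodic points in it are fixed, then the trajectory is trapped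
  near such a point and converges (\<open>finite_subseq_limits_imp_convergent\<close>). A Volterra operator
  has no periodic points other than fixed points (\<open>volterra_periodic_imp_fixed\<close>): along a
  cycle the growth factors \<open>1 + f\<^sub>k\<close> of a nonzero coordinate multiply to 1, so by
  \<open>ln (1 + f) \<le> f\<close> the sum of the \<open>f\<^sub>k\<close> over the cycle is nonnegative. This sum is
  \<open>(A w)\<^sub>k\<close> for \<open>w\<close> the sum of the points of the cycle, and skew-symmetry gives \<open>w \<bullet> A w = 0\<close>; hence
  all these sums vanish, the logarithmic inequality is an equality throughout, and every growth
  factor is 1.

  Together this proves the claim on the weak limit set: if it is finite, the whole trajectory
  converges coordinatewise. The claim on the strong limit set reduces to it: one limit point in
  norm lies in the simplex, so no mass escapes to infinity along the trajectory, all coordinatewise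
  limit points lie in the simplex too, and on the simplex coordinatewise convergence implies
  convergence in norm. So the strong limit set is empty or equal to the weak one
  (\<open>omega_limit_eq_weak\<close>).
\<close>

section \<open>Finite limit sets of discrete dynamical systems\<close>

definition subseq_limits :: "(nat \<Rightarrow> 'a::topological_space) \<Rightarrow> 'a set" where
  "subseq_limits u = {l. \<exists>r :: nat \<Rightarrow> nat. strict_mono r \<and> (\<lambda>j. u (r j)) \<longlonglongrightarrow> l}"

lemma subseq_limits_invariant:
  assumes W: "continuous_on UNIV W" and step: "\<And>n. u (Suc n) = W (u n)"
    and z: "z \<in> subseq_limits u"
  shows "W z \<in> subseq_limits u"
proof -
  obtain r :: "nat \<Rightarrow> nat" where r: "strict_mono r" "(\<lambda>j. u (r j)) \<longlonglongrightarrow> z"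
    using z unfolding subseq_limits_def by blast
  have "(\<lambda>j. W (u (r j))) \<longlonglongrightarrow> W z"
    by (rule continuous_on_tendsto_compose[OF W r(2)]) auto
  then have "(\<lambda>j. u (Suc (r j))) \<longlonglongrightarrow> W z"
    by (simp add: step)
  moreover have "strict_mono (\<lambda>j. Suc (r j))"
    using r(1) by (simp add: strict_mono_def)
  ultimately show ?thesis
    unfolding subseq_limits_def by (auto intro!: exI[of _ "\<lambda>j. Suc (r j)"])
qed

lemma subseq_limits_closed_subset:
  fixes u :: "nat \<Rightarrow> 'a::first_countable_topology"
  assumes "closed C" "\<And>n. u n \<in> C"
  shows "subseq_limits u \<subseteq> C"
proof
  fix l
  assume "l \<in> subseq_limits u"
  then obtain r :: "nat \<Rightarrow> nat" where "(\<lambda>j. u (r j)) \<longlonglongrightarrow> l"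
    unfolding subseq_limits_def by blast
  then show "l \<in> C"
    using closed_sequentially[OF assms(1), of "\<lambda>j. u (r j)" l] assms(2) by simp
qed

text \<open>Infinitely many visits to a compact set would accumulate inside it.\<close>

lemma eventually_avoids_compact:
  fixes u :: "nat \<Rightarrow> 'a::metric_space"
  assumes "compact C" "C \<inter> subseq_limits u = {}"
  shows "\<forall>\<^sub>F n in sequentially. u n \<notin> C"
proof (rule ccontr)
  assume "\<not> ?thesis"
  then have "infinite {n. u n \<in> C}"
    by (simp add: eventually_sequentially infinite_nat_iff_unbounded_le) 
  then obtain r :: "nat \<Rightarrow> nat" where r: "strict_mono r" "\<And>j. u (r j) \<in> C"
    using infinite_enumerate by blast
  then obtain l q where "l \<in> C" and q: "strict_mono q" "((\<lambda>j. u (r j)) \<circ> q) \<longlonglongrightarrow> l"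
    using assms(1) unfolding compact_def by metis
  moreover have "l \<in> subseq_limits u"
    unfolding subseq_limits_def using q strict_mono_o[OF r(1) q(1)]
    by (auto intro!: exI[of _ "r \<circ> q"] simp: o_def)
  ultimately show False
    using assms(2) by blast
qed

text \<open>
  By the pigeonhole principle the orbit of a limit point inside the finite limit set runs into a
  cycle, hence into a fixed point \<open>q\<close>. A trajectory that is close to \<open>q\<close> is still fairly close one
  step later, and since it cannot keep visiting the limit-free region around \<open>q\<close>, it stays close
  forever.
\<close>

proposition finite_subseq_limits_imp_convergent:
  fixes u :: "nat \<Rightarrow> 'a::metric_space"
  assumes K: "compact K" "\<And>n. u n \<in> K"
    and W: "continuous_on UNIV W" and step: "\<And>n. u (Suc n) = W (u n)"
    and fin: "finite (subseq_limits u)"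
    and periodic: "\<And>z p. \<lbrakk>z \<in> subseq_limits u; p > 0; (W ^^ p) z = z\<rbrakk> \<Longrightarrow> W z = z"
  shows "convergent u"
proof -
  obtain z where z: "z \<in> subseq_limits u"
    using K unfolding compact_def subseq_limits_def o_def by blast
  have orbit: "(W ^^ t) z \<in> subseq_limits u" for t
    by (induction t) (use z subseq_limits_invariant[where u = u, OF W step] in auto)
  then have "\<not> inj (\<lambda>t. (W ^^ t) z)"
    using fin finite_subset[of "range (\<lambda>t. (W ^^ t) z)" "subseq_limits u"] range_inj_infinite by blast
  then obtain s t where st: "s < t" "(W ^^ s) z = (W ^^ t) z"
    unfolding inj_def by (metis linorder_neqE_nat)
  define q where "q = (W ^^ s) z"
  have q: "q \<in> subseq_limits u"
    using orbit q_def by simp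
  have "(W ^^ (t - s)) q = (W ^^ (t - s + s)) z"
    unfolding q_def by (simp add: funpow_add)
  then have "(W ^^ (t - s)) q = q"
    using st q_def by simp
  then have fixq: "W q = q"
    using periodic[OF q, of "t - s"] st(1) by simp
  obtain d where d: "d > 0" "\<And>p. p \<in> subseq_limits u \<Longrightarrow> p \<noteq> q \<Longrightarrow> d \<le> dist q p"
    using finite_set_avoid[OF fin, of q] by metis
  have "u \<longlonglongrightarrow> q"
  proof (rule metric_LIMSEQ_I)
    fix e :: real
    assume e: "e > 0"
    have "isCont W q"
      using W by (simp add: continuous_on_eq_continuous_at)
    then obtain \<delta>' where \<delta>': "\<delta>' > 0" "\<And>x. dist x q < \<delta>' \<Longrightarrow> dist (W x) q < d / 2"
      using d(1) unfolding continuous_at_eps_delta fixq by (metis half_gt_zero fixq)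
    define \<delta> where "\<delta> = Min {\<delta>', e, d / 2}"
    have \<delta>: "\<delta> > 0" "\<delta> \<le> \<delta>'" "\<delta> \<le> e" "\<delta> \<le> d / 2"
      using \<delta>'(1) e d(1) unfolding \<delta>_def by auto
    \<comment> \<open>From inside radius \<open>\<delta>\<close> one step lands within radius \<open>d / 2\<close>, so it cannot jump across this
      annulus; and the annulus contains no limit point, so it is eventually not visited.\<close>
    define A where "A = {x. \<delta> \<le> dist x q} \<inter> {x. dist x q \<le> d / 2}"
    have "closed A"
      unfolding A_def by (intro closed_Int closed_Collect_le continuous_intros)
    then have "compact (K \<inter> A)"
      using K(1) by blast
    moreover have "p \<notin> A" if "p \<in> subseq_limits u" for p
      using d(2)[OF that] d(1) \<delta>(1) unfolding A_def by (cases "p = q") (auto simp: dist_commute)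
    ultimately have "\<forall>\<^sub>F n in sequentially. u n \<notin> K \<inter> A"
      using eventually_avoids_compact[of "K \<inter> A" u] by blast
    then obtain N where N: "\<And>n. n \<ge> N \<Longrightarrow> u n \<notin> A"
      using K(2) unfolding eventually_sequentially by blast
    obtain r :: "nat \<Rightarrow> nat" where r: "strict_mono r" "(\<lambda>j. u (r j)) \<longlonglongrightarrow> q"
      using q unfolding subseq_limits_def by blast
    then obtain j0 where j0: "\<And>j. j \<ge> j0 \<Longrightarrow> dist (u (r j)) q < \<delta>"
      using metric_LIMSEQ_D \<delta>(1) by blast
    define M where "M = r (max N j0)"
    have M: "M \<ge> N" "dist (u M) q < \<delta>"
      using seq_suble[OF r(1), of "max N j0"] j0[of "max N j0"] unfolding M_def by auto
    have "dist (u n) q < \<delta>" if "n \<ge> M" for n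
      using that
    proof (induction n rule: dec_induct)
      case base
      show ?case by (rule M(2))
    next
      case (step n)
      then have "dist (u (Suc n)) q < d / 2"
        using \<delta>'(2) \<delta>(2) assms(4) by simp
      moreover have "u (Suc n) \<notin> A"
        using N step.hyps M(1) by simp
      ultimately show ?case
        unfolding A_def by auto
    qed
    then show "\<exists>M. \<forall>n\<ge>M. dist (u n) q < e"
      using \<delta>(3) by fastforce
  qed
  then show ?thesis
    unfolding convergent_def by blast
qed

section \<open>Coordinatewise convergence and convergence in the simplex\<close>

text \<open>
  Coordinatewise convergence is convergence in the product topology on functions, which for a
  countable index set is metrizable; this makes the results on metric spaces above applicable.
\<close>

lemma tendsto_coordinatewise_iff:
  fixes f :: "'b \<Rightarrow> 'i \<Rightarrow> 'a::topological_space"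
  shows "(f \<longlongrightarrow> l) F \<longleftrightarrow> (\<forall>i. ((\<lambda>x. f x i) \<longlongrightarrow> l i) F)"
proof -
  have "limitin (product_topology (\<lambda>i. euclidean) UNIV) f l F
      \<longleftrightarrow> (\<forall>i. ((\<lambda>x. f x i) \<longlongrightarrow> l i) F)"
    by (simp add: limitin_componentwise)
  then show ?thesis
    by (simp add: euclidean_product_topology)
qed

lemma compact_unit_cube: "compact {x :: 'i \<Rightarrow> real. \<forall>i. x i \<in> {0..1}}"
proof -
  have "compactin (product_topology (\<lambda>i::'i. euclidean) UNIV) (PiE UNIV (\<lambda>i. {0..1::real}))"
    by (simp add: compactin_PiE)
  moreover have "PiE UNIV (\<lambda>i. {0..1::real}) = {x :: 'i \<Rightarrow> real. \<forall>i. x i \<in> {0..1}}"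
    by (auto simp: PiE_def Pi_def)
  ultimately show ?thesis
    by (simp add: euclidean_product_topology)
qed

lemma inf_simplex_sums: "x \<in> inf_simplex \<longleftrightarrow> (\<forall>k. 0 \<le> x k) \<and> x sums 1"
proof
  assume "x \<in> inf_simplex"
  then have "\<forall>k. 0 \<le> x k" "summable x" "suminf x = 1"
    unfolding inf_simplex_def ell1_def ell1_norm_def by auto
  then show "(\<forall>k. 0 \<le> x k) \<and> x sums 1"
    using summable_sums by metis
next
  assume "(\<forall>k. 0 \<le> x k) \<and> x sums 1"
  then show "x \<in> inf_simplex"
    unfolding inf_simplex_def ell1_def ell1_norm_def
    by (auto simp: sums_iff)
qed

lemma inf_simplex_partial_sum_le_1:
  assumes "x \<in> inf_simplex" "finite A"
  shows "sum x A \<le> 1"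
  using assms sum_le_suminf[of x A] unfolding inf_simplex_sums sums_iff by auto

lemma inf_simplex_coord_bounds:
  assumes "x \<in> inf_simplex"
  shows "0 \<le> x k" "x k \<le> 1"
  using inf_simplex_partial_sum_le_1[OF assms, of "{k}"] assms unfolding inf_simplex_sums by auto

lemma ell1_tendsto_imp_pointwise:
  assumes "ell1_tendsto u y"
  shows "pointwise_tendsto u y"
  unfolding pointwise_tendsto_def
proof
  fix k
  have sm: "summable (\<lambda>k. \<bar>u j k - y k\<bar>)" for j
  proof (rule summable_comparison_test')
    show "summable (\<lambda>k. \<bar>u j k\<bar> + \<bar>y k\<bar>)"
      using assms unfolding ell1_tendsto_def ell1_def by (auto intro: summable_add)
    show "norm \<bar>u j k - y k\<bar> \<le> \<bar>u j k\<bar> + \<bar>y k\<bar>" if "k \<ge> 0" for k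
      by simp
  qed
  have "\<bar>u j k - y k\<bar> \<le> ell1_norm (\<lambda>k. u j k - y k)" for j
    using sum_le_suminf[OF sm[of j], of "{k}"] unfolding ell1_norm_def by auto
  moreover have "(\<lambda>j. ell1_norm (\<lambda>k. u j k - y k)) \<longlonglongrightarrow> 0"
    using assms unfolding ell1_tendsto_def by blast
  ultimately have "(\<lambda>j. u j k - y k) \<longlonglongrightarrow> 0"
    using Lim_null_comparison[of "\<lambda>j. u j k - y k" "\<lambda>j. ell1_norm (\<lambda>k. u j k - y k)"]
    by (simp add: always_eventually)
  then show "(\<lambda>j. u j k) \<longlonglongrightarrow> y k"
    by (simp add: LIM_zero_iff)
qed

lemma inf_simplex_ell1_closed:
  assumes "\<And>j. u j \<in> inf_simplex" "ell1_tendsto u y"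
  shows "y \<in> inf_simplex"
proof -
  have pw: "(\<lambda>j. u j k) \<longlonglongrightarrow> y k" for k
    using ell1_tendsto_imp_pointwise[OF assms(2)] unfolding pointwise_tendsto_def by blast
  have nonneg: "0 \<le> y k" for k
    using LIMSEQ_le_const[OF pw] inf_simplex_coord_bounds(1)[OF assms(1)] by blast
  have smy: "summable y"
    using assms(2) nonneg unfolding ell1_tendsto_def ell1_def by simp
  have smu: "summable (u j)" "suminf (u j) = 1" for j
    using assms(1) unfolding inf_simplex_sums sums_iff by auto
  have "\<bar>1 - suminf y\<bar> \<le> ell1_norm (\<lambda>k. u j k - y k)" for j
  proof -
    have "summable (\<lambda>k. \<bar>u j k - y k\<bar>)"
    proof (rule summable_comparison_test')
      show "summable (\<lambda>k. u j k + y k)"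
        using smy smu by (intro summable_add)
      show "norm \<bar>u j k - y k\<bar> \<le> u j k + y k" if "k \<ge> 0" for k
        using nonneg[of k] inf_simplex_coord_bounds(1)[OF assms(1), of j k] by simp
    qed
    then have "\<bar>\<Sum>k. u j k - y k\<bar> \<le> (\<Sum>k. \<bar>u j k - y k\<bar>)"
      by (rule summable_rabs)
    then show ?thesis
      using suminf_diff[OF smu(1)[of j] smy] smu(2)[of j] unfolding ell1_norm_def by simp
  qed
  then have "\<bar>1 - suminf y\<bar> \<le> 0"
    using assms(2) LIMSEQ_le_const[of "\<lambda>j. ell1_norm (\<lambda>k. u j k - y k)" 0 "\<bar>1 - suminf y\<bar>"]
    unfolding ell1_tendsto_def by simp
  then show ?thesis
    using nonneg smy unfolding inf_simplex_sums sums_iff by auto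
qed

text \<open>
  This is Scheffe's lemma for sequences. Since \<open>u\<close> and \<open>z\<close> have equal mass, their distance is twice
  the mass of the positive part of \<open>z - u\<close>, which is dominated by the fixed summable sequence \<open>z\<close>;
  Tannery's theorem then allows taking limits coordinatewise.
\<close>

lemma inf_simplex_pointwise_imp_ell1:
  assumes u: "\<And>j. u j \<in> inf_simplex" and z: "z \<in> inf_simplex"
    and lim: "pointwise_tendsto u z"
  shows "ell1_tendsto u z"
proof -
  have nn: "0 \<le> z k" "0 \<le> u j k" for j k
    using inf_simplex_coord_bounds(1) u z by auto
  have sm: "summable z" "suminf z = 1" "summable (u j)" "suminf (u j) = 1" for j
    using u z unfolding inf_simplex_sums sums_iff by auto
  define g where "g j k = max (z k - u j k) 0" for j k
  have gz: "norm (g j k) \<le> z k" for j k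
    using nn(1)[of k] nn(2)[of j k] unfolding g_def by auto
  have gsm: "summable (g j)" for j
    by (rule summable_comparison_test'[OF sm(1)]) (rule gz)
  have "(\<lambda>j. g j k) \<longlonglongrightarrow> 0" for k
  proof -
    have "(\<lambda>j. max (z k - u j k) 0) \<longlonglongrightarrow> max (z k - z k) 0"
      using lim unfolding pointwise_tendsto_def by (intro tendsto_intros) auto
    then show ?thesis
      unfolding g_def by simp
  qed
  then have "(\<lambda>j. suminf (g j)) \<longlonglongrightarrow> (\<Sum>k. 0)"
    using tannerys_theorem[where a = "\<lambda>k j. g j k" and b = "\<lambda>k. 0" and M = z and F = sequentially]
      gz sm(1) by (auto simp: always_eventually case_prod_beta)
  then have lim0: "(\<lambda>j. 2 * suminf (g j)) \<longlonglongrightarrow> 0"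
    using tendsto_mult_right_zero by fastforce
  have "ell1_norm (\<lambda>k. u j k - z k) = 2 * suminf (g j)" for j
  proof -
    have "(\<lambda>k. (u j k - z k) + 2 * g j k) sums ((1 - 1) + 2 * suminf (g j))"
      using sm gsm by (intro sums_add sums_diff sums_mult) (auto simp: sums_iff)
    moreover have "(u j k - z k) + 2 * g j k = \<bar>u j k - z k\<bar>" for k
      unfolding g_def by (simp add: max_def abs_if)
    ultimately show ?thesis
      unfolding ell1_norm_def by (simp add: sums_iff)
  qed
  then show ?thesis
    using lim0 u z unfolding ell1_tendsto_def inf_simplex_def by simp
qed

section \<open>Periodic points of finite-dimensional Volterra operators\<close>

text \<open>Both parts come from \<open>ln (1 + g) \<le> g\<close>, with equality only for \<open>g = 0\<close>.\<close>

lemma prod_eq_1_imp_sum_nonneg: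
  fixes g :: "'a \<Rightarrow> real"
  assumes "finite T" "\<And>t. t \<in> T \<Longrightarrow> 0 \<le> 1 + g t" "(\<Prod>t\<in>T. 1 + g t) = 1"
  shows "0 \<le> sum g T" and "sum g T = 0 \<Longrightarrow> t \<in> T \<Longrightarrow> g t = 0"
proof -
  have pos: "0 < 1 + g t" if "t \<in> T" for t
  proof -
    have "1 + g t \<noteq> 0"
      using assms(1,3) that by (metis prod_zero zero_neq_one)
    then show ?thesis
      using assms(2)[OF that] by simp
  qed
  have "ln (\<Prod>t\<in>T. 1 + g t) = (\<Sum>t\<in>T. ln (1 + g t))"
    by (rule ln_prod) (use assms(1) pos in fastforce)+
  then have ln0: "(\<Sum>t\<in>T. ln (1 + g t)) = 0"
    using assms(3) by simp
  have le: "ln (1 + g t) \<le> g t" if "t \<in> T" for t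
    using ln_le_minus_one[OF pos[OF that]] by simp
  show "0 \<le> sum g T"
    using sum_mono[of T "\<lambda>t. ln (1 + g t)" g] le ln0 by simp
  assume s0: "sum g T = 0" and t: "t \<in> T"
  have "(\<Sum>t\<in>T. g t - ln (1 + g t)) = 0"
    using s0 ln0 by (simp add: sum_subtractf)
  then have "g t - ln (1 + g t) = 0"
    using sum_nonneg_eq_0_iff[OF assms(1), of "\<lambda>t. g t - ln (1 + g t)"] le t by simp
  then show "g t = 0"
    using ln_eq_minus_one[OF pos[OF t]] by simp
qed

lemma skew_quadratic_form_zero:
  fixes a :: "'i \<Rightarrow> 'i \<Rightarrow> real"
  assumes "\<And>k i. a k i = - a i k"
  shows "(\<Sum>k\<in>A. w k * (\<Sum>i\<in>A. a k i * w i)) = 0"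
proof -
  let ?Q = "\<Sum>k\<in>A. \<Sum>i\<in>A. a k i * (w k * w i)"
  have "?Q = (\<Sum>k\<in>A. \<Sum>i\<in>A. a i k * (w k * w i))"
    by (subst sum.swap) (simp add: mult.commute mult.left_commute)
  also have "\<dots> = (\<Sum>k\<in>A. \<Sum>i\<in>A. - (a k i * (w k * w i)))"
    by (intro sum.cong refl) (subst assms, simp)
  also have "\<dots> = - ?Q"
    by (simp add: sum_negf)
  finally show ?thesis
    by (simp add: sum_distrib_left mult.left_commute)
qed

text \<open>
  The sequence \<open>z\<close> is the orbit of a periodic point, and \<open>w\<close> in the proof is the sum over one period.
  Each term of \<open>w \<bullet> A w = 0\<close> is nonnegative, so each is zero, and the equality case of
  \<open>prod_eq_1_imp_sum_nonneg\<close> applies to every coordinate in the support. The condition on the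
  mass keeps all growth factors nonnegative.
\<close>

proposition volterra_periodic_imp_fixed:
  fixes z :: "nat \<Rightarrow> nat \<Rightarrow> real"
  assumes a: "volterra_matrix a"
    and step: "\<And>t k. k < m \<Longrightarrow> z (Suc t) k = z t k * (1 + (\<Sum>i<m. a k i * z t i))"
    and nonneg: "\<And>t k. k < m \<Longrightarrow> 0 \<le> z t k"
    and mass: "\<And>t. (\<Sum>i<m. z t i) \<le> 1"
    and period: "p > 0" "\<And>k. k < m \<Longrightarrow> z p k = z 0 k"
    and k: "k < m"
  shows "z 1 k = z 0 k"
proof -
  define f where "f t k = (\<Sum>i<m. a k i * z t i)" for t k
  define w where "w i = (\<Sum>t<p. z t i)" for i
  have skew: "a k i = - a i k" and bound: "\<bar>a k i\<bar> \<le> 1" for k i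
    using a unfolding volterra_matrix_def by blast+
  have f_ge: "0 \<le> 1 + f t k" for t k
  proof -
    have "(\<Sum>i<m. - z t i) \<le> f t k"
      unfolding f_def
    proof (rule sum_mono)
      fix i assume "i \<in> {..<m}"
      then have "0 \<le> z t i * (1 + a k i)"
        using nonneg[of i t] bound[of k i] by (intro mult_nonneg_nonneg) auto
      then show "- z t i \<le> a k i * z t i"
        by (simp add: algebra_simps)
    qed
    then show ?thesis
      using mass[of t] by (simp add: sum_negf)
  qed
  have orbit: "z n k = z 0 k * (\<Prod>t<n. 1 + f t k)" if "k < m" for n k
    by (induction n) (use step[OF that] f_def in \<open>auto simp: mult.assoc\<close>)
  have prod1: "(\<Prod>t<p. 1 + f t k) = 1" if "k < m" "z 0 k \<noteq> 0" for k
    using orbit[OF that(1), of p] period(2)[OF that(1)] that(2) by simp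
  have w_nonneg: "0 \<le> w k" if "k < m" for k
    unfolding w_def using nonneg[OF that] by (intro sum_nonneg) auto
  have w_pos: "0 < w k" if "k < m" "z 0 k \<noteq> 0" for k
  proof -
    have "z 0 k \<le> w k"
      unfolding w_def using period(1) nonneg[OF that(1)] by (intro member_le_sum) auto
    then show ?thesis
      using nonneg[OF that(1), of 0] that(2) by simp
  qed
  have w_zero: "w k = 0" if "k < m" "z 0 k = 0" for k
    unfolding w_def using orbit[OF that(1)] that(2) by simp
  have Aw: "(\<Sum>i<m. a k i * w i) = (\<Sum>t<p. f t k)" for k
    unfolding w_def f_def sum_distrib_left by (rule sum.swap)
  have term_nonneg: "0 \<le> w k * (\<Sum>i<m. a k i * w i)" if "k < m" for k
  proof (cases "z 0 k = 0")
    case False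
    then have "0 \<le> (\<Sum>t<p. f t k)"
      using prod_eq_1_imp_sum_nonneg(1)[of "{..<p}" "\<lambda>t. f t k"] prod1[OF that] f_ge by simp
    then show ?thesis
      unfolding Aw using w_nonneg[OF that] by simp
  qed (use w_zero[OF that] in simp)
  have "(\<Sum>k<m. w k * (\<Sum>i<m. a k i * w i)) = 0"
    by (rule skew_quadratic_form_zero[OF skew])
  then have term_zero: "w k * (\<Sum>i<m. a k i * w i) = 0" if "k < m" for k
    using that term_nonneg
      sum_nonneg_eq_0_iff[of "{..<m}" "\<lambda>k. w k * (\<Sum>i<m. a k i * w i)"] by auto
  show ?thesis
  proof (cases "z 0 k = 0")
    case True
    then show ?thesis
      using orbit[OF k, of 1] by simp
  next
    case False
    then have "(\<Sum>t<p. f t k) = 0"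
      using term_zero[OF k] w_pos[OF k] unfolding Aw by simp
    then have "f 0 k = 0"
      using prod_eq_1_imp_sum_nonneg(2)[of "{..<p}" "\<lambda>t. f t k" 0] prod1[OF k False] f_ge period(1)
      by simp
    then show ?thesis
      using orbit[OF k, of 1] by simp
  qed
qed

section \<open>Trajectories of block diagonal Volterra operators\<close>

text \<open>The factor \<open>s\<close> is 1 or -1 in the two cases of interest; it allows treating them at once.\<close>

locale block_volterra =
  fixes V :: "(nat \<Rightarrow> real) \<Rightarrow> (nat \<Rightarrow> real)" and a :: "nat \<Rightarrow> nat \<Rightarrow> real"
    and m :: nat and s :: real and x0 :: "nat \<Rightarrow> real"
  assumes V: "volterra_operator V a"
    and decoupled: "\<And>k i. k < m \<Longrightarrow> m \<le> i \<Longrightarrow> a k i = 0"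
    and s: "s \<noteq> 0" and sign: "\<And>k i. m \<le> k \<Longrightarrow> k < i \<Longrightarrow> 0 \<le> s * a k i"
    and x0: "x0 \<in> inf_simplex"
begin

definition x :: "nat \<Rightarrow> nat \<Rightarrow> real" where
  "x n = (V ^^ n) x0"

definition trunc :: "(nat \<Rightarrow> real) \<Rightarrow> nat \<Rightarrow> real" where
  "trunc y = (\<lambda>k. if k < m then y k else 0)"

text \<open>
  The dynamics of the finite block, extended by zero to all sequences. Unlike \<open>V\<close>, which sums over
  infinitely many coordinates, it is continuous for coordinatewise convergence.
\<close>

definition W :: "(nat \<Rightarrow> real) \<Rightarrow> nat \<Rightarrow> real" where
  "W y = trunc (\<lambda>k. y k * (1 + (\<Sum>i<m. a k i * y i)))"

lemma skew: "a k i = - a i k" and bound: "\<bar>a k i\<bar> \<le> 1"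
  using V unfolding volterra_operator_def volterra_matrix_def by blast+

lemma x_in_simplex: "x n \<in> inf_simplex"
  unfolding x_def using V x0 unfolding volterra_operator_def by (induction n) auto

lemma x_Suc: "x (Suc n) k = x n k * (1 + (\<Sum>i. a k i * x n i))"
  using V x_in_simplex[of n] unfolding volterra_operator_def by (simp add: x_def)

lemma row_summable: "summable (\<lambda>i. a k i * x n i)"
proof (rule summable_comparison_test')
  show "summable (x n)"
    using x_in_simplex unfolding inf_simplex_sums sums_iff by blast
  show "norm (a k i * x n i) \<le> x n i" if "i \<ge> 0" for i
    using bound[of k i] inf_simplex_coord_bounds(1)[OF x_in_simplex, of n i]
    by (simp add: abs_mult mult_left_le_one_le)
qed

lemma trunc_x_Suc: "trunc (x (Suc n)) = W (trunc (x n))"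
proof
  fix k
  show "trunc (x (Suc n)) k = W (trunc (x n)) k"
  proof (cases "k < m")
    case True
    have "(\<Sum>i. a k i * x n i) = (\<Sum>i<m. a k i * x n i)"
      by (rule suminf_finite) (use decoupled[OF True] in auto)
    then show ?thesis
      using True by (simp add: trunc_def W_def x_Suc)
  qed (simp add: trunc_def W_def)
qed

lemma continuous_W: "continuous_on UNIV W"
proof (rule continuous_on_coordinatewise_then_product)
  fix k
  show "continuous_on UNIV (\<lambda>y. W y k)"
    unfolding W_def trunc_def
    by (cases "k < m") (auto intro!: continuous_intros)
qed

text \<open>
  Splitting each row sum at \<open>N\<close>, the contribution of the indices below \<open>N\<close> cancels by skew-symmetry,
  and what remains has the sign of the entries \<open>a k i\<close> with \<open>k < N \<le> i\<close>. These are zero for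
  \<open>k < m\<close>, so counting the mass of the finite block too does no harm.
\<close>

lemma partial_sum_monotone:
  assumes "m \<le> N"
  shows "s * (\<Sum>k<N. x n k) \<le> s * (\<Sum>k<N. x (Suc n) k)"
proof -
  have split: "(\<Sum>i. a k i * x n i)
      = (\<Sum>i<N. a k i * x n i) + (\<Sum>i. a k (i + N) * x n (i + N))" for k
    using suminf_split_initial_segment[OF row_summable, of k n N] by simp
  have "(\<Sum>k<N. x (Suc n) k)
      = (\<Sum>k<N. x n k) + (\<Sum>k<N. x n k * (\<Sum>i<N. a k i * x n i))
        + (\<Sum>k<N. x n k * (\<Sum>i. a k (i + N) * x n (i + N)))"
    unfolding x_Suc split by (simp add: algebra_simps sum.distrib)
  also have "\<dots> = (\<Sum>k<N. x n k) + (\<Sum>k<N. x n k * (\<Sum>i. a k (i + N) * x n (i + N)))"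
    using skew_quadratic_form_zero[where A = "{..<N}" and w = "x n", OF skew] by simp
  finally have growth: "s * (\<Sum>k<N. x (Suc n) k)
      = s * (\<Sum>k<N. x n k) + (\<Sum>k<N. x n k * (s * (\<Sum>i. a k (i + N) * x n (i + N))))"
    by (simp add: algebra_simps sum_distrib_left)
  have "0 \<le> x n k * (s * (\<Sum>i. a k (i + N) * x n (i + N)))" if "k < N" for k
  proof -
    have sa: "0 \<le> s * a k (i + N)" for i
      using decoupled[of k "i + N"] sign[of k "i + N"] that assms by (cases "k < m") auto
    have "s * (\<Sum>i. a k (i + N) * x n (i + N)) = (\<Sum>i. s * (a k (i + N) * x n (i + N)))"
      by (rule suminf_mult[symmetric]) (rule summable_ignore_initial_segment[OF row_summable])
    also have "\<dots> \<ge> 0"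
    proof (rule suminf_nonneg)
      show "summable (\<lambda>i. s * (a k (i + N) * x n (i + N)))"
        by (intro summable_mult summable_ignore_initial_segment[OF row_summable])
      show "0 \<le> s * (a k (i + N) * x n (i + N))" for i
        using sa[of i] inf_simplex_coord_bounds(1)[OF x_in_simplex]
        by (metis mult.assoc mult_nonneg_nonneg)
    qed
    finally show ?thesis
      using inf_simplex_coord_bounds(1)[OF x_in_simplex] by simp
  qed
  then have "0 \<le> (\<Sum>k<N. x n k * (s * (\<Sum>i. a k (i + N) * x n (i + N))))"
    by (intro sum_nonneg) auto
  then show ?thesis
    using growth by simp
qed

lemma partial_sum_convergent:
  assumes "m \<le> N"
  shows "convergent (\<lambda>n. \<Sum>k<N. x n k)"
proof -
  have "norm (s * (\<Sum>k<N. x n k)) \<le> \<bar>s\<bar>" for n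
  proof -
    have "0 \<le> (\<Sum>k<N. x n k)"
      using inf_simplex_coord_bounds(1)[OF x_in_simplex] by (simp add: sum_nonneg)
    then show ?thesis
      using inf_simplex_partial_sum_le_1[OF x_in_simplex, of "{..<N}" n]
      by (simp add: abs_mult mult_left_le)
  qed
  then have "Bseq (\<lambda>n. s * (\<Sum>k<N. x n k))"
    by (rule BseqI')
  moreover have "incseq (\<lambda>n. s * (\<Sum>k<N. x n k))"
    using partial_sum_monotone[OF assms] by (rule incseq_SucI)
  ultimately have "convergent (\<lambda>n. s * (\<Sum>k<N. x n k))"
    using Bseq_monoseq_convergent incseq_imp_monoseq by blast
  then show ?thesis
    using s by (simp add: convergent_mult_const_iff)
qed

lemma tail_coord_convergent:
  assumes "m \<le> k"
  shows "convergent (\<lambda>n. x n k)"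
proof -
  have "convergent (\<lambda>n. (\<Sum>i<Suc k. x n i) - (\<Sum>i<k. x n i))"
    by (intro convergent_diff partial_sum_convergent) (use assms in auto)
  then show ?thesis
    by simp
qed

lemma omega_limit_weak_eq: "omega_limit_weak V x0 = subseq_limits x"
  unfolding omega_limit_weak_def subseq_limits_def pointwise_tendsto_def tendsto_coordinatewise_iff
  by (simp add: x_def)

text \<open>
  Because the other coordinates converge along the full trajectory, every limit point of the finite
  block extends to a limit point of the whole trajectory along the same subsequence.
\<close>

lemma subseq_limits_trunc_subset: "subseq_limits (\<lambda>n. trunc (x n)) \<subseteq> trunc ` subseq_limits x"
proof
  fix z
  assume "z \<in> subseq_limits (\<lambda>n. trunc (x n))"
  then obtain r :: "nat \<Rightarrow> nat" where r: "strict_mono r"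
      "\<And>k. (\<lambda>j. trunc (x (r j)) k) \<longlonglongrightarrow> z k"
    unfolding subseq_limits_def tendsto_coordinatewise_iff by blast
  define y where "y k = (if k < m then z k else lim (\<lambda>n. x n k))" for k
  have "(\<lambda>j. x (r j) k) \<longlonglongrightarrow> y k" for k
  proof (cases "k < m")
    case True
    then show ?thesis
      using r(2)[of k] by (simp add: trunc_def y_def)
  next
    case False
    then have "(\<lambda>n. x n k) \<longlonglongrightarrow> y k"
      using tail_coord_convergent[of k] by (simp add: y_def convergent_LIMSEQ_iff)
    then show ?thesis
      using LIMSEQ_subseq_LIMSEQ[OF _ r(1)] by (fastforce simp: o_def)
  qed
  then have "y \<in> subseq_limits x"
    unfolding subseq_limits_def tendsto_coordinatewise_iff using r(1) by blast
  moreover have "z k = 0" if "\<not> k < m" for k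
    using r(2)[of k] that by (simp add: trunc_def LIMSEQ_const_iff)
  then have "z = trunc y"
    by (auto simp: trunc_def y_def)
  ultimately show "z \<in> trunc ` subseq_limits x"
    by blast
qed

lemma finite_omega_limit_weak_imp_convergent:
  assumes "finite (omega_limit_weak V x0)"
  shows "convergent x"
proof -
  let ?u = "\<lambda>n. trunc (x n)"
  let ?D = "{y :: nat \<Rightarrow> real. (\<forall>k. 0 \<le> y k) \<and> (\<Sum>i<m. y i) \<le> 1}"
  have "closed ?D"
    by (intro closed_Collect_conj closed_Collect_all closed_Collect_le continuous_intros
        continuous_on_product_coordinates)
  moreover have "?u n \<in> ?D" for n
    using inf_simplex_coord_bounds(1)[OF x_in_simplex]
      inf_simplex_partial_sum_le_1[OF x_in_simplex, of "{..<m}" n] by (simp add: trunc_def)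
  ultimately have LD: "subseq_limits ?u \<subseteq> ?D"
    by (rule subseq_limits_closed_subset)
  have "convergent ?u"
  proof (rule finite_subseq_limits_imp_convergent[where u = ?u, OF compact_unit_cube _
        continuous_W trunc_x_Suc])
    show "?u n \<in> {y. \<forall>i. y i \<in> {0..1}}" for n
      using inf_simplex_coord_bounds[OF x_in_simplex] by (simp add: trunc_def)
    show "finite (subseq_limits ?u)"
      using assms subseq_limits_trunc_subset finite_subset unfolding omega_limit_weak_eq by blast
    fix z p
    assume z: "z \<in> subseq_limits ?u" and p: "0 < (p::nat)" "(W ^^ p) z = z"
    have orbit: "(W ^^ t) z \<in> ?D" for t
    proof -
      have "(W ^^ t) z \<in> subseq_limits ?u"
        by (induction t) (use z subseq_limits_invariant[where u = ?u, OF continuous_W trunc_x_Suc] in auto)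
      then show ?thesis
        using LD by blast
    qed
    have W_step: "(W ^^ Suc t) z k = (W ^^ t) z k * (1 + (\<Sum>i<m. a k i * (W ^^ t) z i))"
      if "k < m" for t k
      using that unfolding funpow.simps o_apply by (simp add: W_def[of "(W ^^ t) z"] trunc_def)
    show "W z = z"
    proof
      fix k
      show "W z k = z k"
      proof (cases "k < m")
        case True
        have "(W ^^ 1) z k = (W ^^ 0) z k"
          by (rule volterra_periodic_imp_fixed[where m = m and a = a and p = p])
            (use V orbit p True W_step in \<open>auto simp: volterra_operator_def\<close>)
        then show ?thesis
          by simp
      next
        case False
        have "(W ^^ p) z k = 0"
          using p(1) False by (cases p) (auto simp: W_def trunc_def)
        then show ?thesis
          using p(2) False by (simp add: W_def trunc_def)
      qed
    qed
  qed
  then obtain l where l: "\<And>k. (\<lambda>n. trunc (x n) k) \<longlonglongrightarrow> l k"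
    unfolding convergent_def tendsto_coordinatewise_iff by blast
  have "convergent (\<lambda>n. x n k)" for k
    using l[of k] tail_coord_convergent[of k] unfolding convergent_def trunc_def
    by (cases "k < m") auto
  then have "\<forall>k. \<exists>y. (\<lambda>n. x n k) \<longlonglongrightarrow> y"
    unfolding convergent_def by blast
  then obtain y where "\<And>k. (\<lambda>n. x n k) \<longlonglongrightarrow> y k"
    by metis
  then show ?thesis
    unfolding convergent_def tendsto_coordinatewise_iff by blast
qed

lemma omega_limit_weak_singleton_or_infinite:
  "(\<exists>y. omega_limit_weak V x0 = {y}) \<or> infinite (omega_limit_weak V x0)"
proof (rule disjCI)
  assume "\<not> infinite (omega_limit_weak V x0)"
  then obtain y where y: "x \<longlonglongrightarrow> y"
    using finite_omega_limit_weak_imp_convergent unfolding convergent_def by blast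
  have "l = y" if "strict_mono r" "(\<lambda>j. x (r j)) \<longlonglongrightarrow> l" for l and r :: "nat \<Rightarrow> nat"
    using LIMSEQ_unique[OF that(2)] LIMSEQ_subseq_LIMSEQ[OF y that(1)] by (simp add: o_def)
  moreover have "y \<in> subseq_limits x"
    unfolding subseq_limits_def using y by (auto intro!: exI[of _ id] simp: strict_mono_def)
  ultimately show "\<exists>y. omega_limit_weak V x0 = {y}"
    unfolding omega_limit_weak_eq subseq_limits_def by blast
qed

lemma omega_limit_subset_weak: "omega_limit V x0 \<subseteq> omega_limit_weak V x0"
  unfolding omega_limit_def omega_limit_weak_def using ell1_tendsto_imp_pointwise by blast

text \<open>
  The partial sums converge along the full trajectory, so all limit points have the same ones. In
  particular either all limit points lie in the simplex or none does.
\<close>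

lemma omega_limit_weak_partial_sum:
  assumes "y \<in> omega_limit_weak V x0" "m \<le> N"
  shows "(\<Sum>k<N. y k) = lim (\<lambda>n. \<Sum>k<N. x n k)"
proof -
  obtain r :: "nat \<Rightarrow> nat" where r: "strict_mono r" "\<And>k. (\<lambda>j. x (r j) k) \<longlonglongrightarrow> y k"
    using assms(1) unfolding omega_limit_weak_def pointwise_tendsto_def x_def by blast
  have "(\<lambda>j. \<Sum>k<N. x (r j) k) \<longlonglongrightarrow> (\<Sum>k<N. y k)"
    by (intro tendsto_sum r(2))
  moreover have "(\<lambda>j. \<Sum>k<N. x (r j) k) \<longlonglongrightarrow> lim (\<lambda>n. \<Sum>k<N. x n k)"
    using LIMSEQ_subseq_LIMSEQ[OF _ r(1)] partial_sum_convergent[OF assms(2)]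
    unfolding convergent_LIMSEQ_iff by (fastforce simp: o_def)
  ultimately show ?thesis
    by (rule LIMSEQ_unique)
qed

lemma omega_limit_eq_weak:
  assumes "omega_limit V x0 \<noteq> {}"
  shows "omega_limit V x0 = omega_limit_weak V x0"
proof
  show "omega_limit_weak V x0 \<subseteq> omega_limit V x0"
  proof
    fix z
    assume z: "z \<in> omega_limit_weak V x0"
    then obtain r :: "nat \<Rightarrow> nat" where r: "strict_mono r" "pointwise_tendsto (\<lambda>j. x (r j)) z"
      unfolding omega_limit_weak_def x_def by blast
    obtain y where y: "y \<in> omega_limit V x0"
      using assms by blast
    then obtain r' :: "nat \<Rightarrow> nat" where "ell1_tendsto (\<lambda>j. x (r' j)) y"
      unfolding omega_limit_def x_def by blast
    then have "y \<in> inf_simplex"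
      by (rule inf_simplex_ell1_closed[OF x_in_simplex])
    then have "(\<lambda>N. \<Sum>k<N. y k) \<longlonglongrightarrow> 1"
      unfolding inf_simplex_sums sums_def by blast
    moreover have "\<forall>\<^sub>F N in sequentially. (\<Sum>k<N. y k) = (\<Sum>k<N. z k)"
      using omega_limit_weak_partial_sum z y omega_limit_subset_weak
      by (intro eventually_sequentiallyI[of m]) (metis subsetD)
    ultimately have "z sums 1"
      unfolding sums_def by (rule Lim_transform_eventually)
    moreover have "0 \<le> z k" for k
      using r(2) inf_simplex_coord_bounds(1)[OF x_in_simplex]
        LIMSEQ_le_const[of "\<lambda>j. x (r j) k" "z k" 0]
      unfolding pointwise_tendsto_def by simp
    ultimately have "ell1_tendsto (\<lambda>j. x (r j)) z"
      using r(2) x_in_simplex by (intro inf_simplex_pointwise_imp_ell1) (auto simp: inf_simplex_sums)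
    then show "z \<in> omega_limit V x0"
      unfolding omega_limit_def using r(1) x_def by auto
  qed
qed (rule omega_limit_subset_weak)

end

theorem theorem1p2:
  fixes V :: "(nat \<Rightarrow> real) \<Rightarrow> (nat \<Rightarrow> real)"
  assumes "V \<in> Volterra_plus \<union> Volterra_minus"
  shows "\<forall>x0 \<in> inf_simplex.
    (omega_limit V x0 \<noteq> {} \<longrightarrow>
      (\<exists>y. omega_limit V x0 = {y}) \<or> infinite (omega_limit V x0)) \<and>
    ((\<exists>y. omega_limit_weak V x0 = {y}) \<or> infinite (omega_limit_weak V x0))"
proof
  fix x0
  assume x0: "x0 \<in> inf_simplex"
  have "\<exists>a m s. block_volterra V a m s x0"
    using assms
  proof
    assume "V \<in> Volterra_plus"
    then obtain a m where "volterra_operator V a" "\<forall>k i. k < m \<and> m \<le> i \<longrightarrow> a k i = 0"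
        "\<forall>k i. m \<le> k \<and> k < i \<longrightarrow> 0 \<le> a k i"
      unfolding Volterra_plus_def by blast
    then have "block_volterra V a m 1 x0"
      using x0 by unfold_locales auto
    then show ?thesis
      by blast
  next
    assume "V \<in> Volterra_minus"
    then obtain a m where "volterra_operator V a" "\<forall>k i. k < m \<and> m \<le> i \<longrightarrow> a k i = 0"
        "\<forall>k i. m \<le> k \<and> k < i \<longrightarrow> a k i \<le> 0"
      unfolding Volterra_minus_def by blast
    then have "block_volterra V a m (- 1) x0"
      using x0 by unfold_locales auto
    then show ?thesis
      by blast
  qed
  then obtain a m s where "block_volterra V a m s x0"
    by blast
  then interpret block_volterra V a m s x0 .
  show "(omega_limit V x0 \<noteq> {} \<longrightarrow>
      (\<exists>y. omega_limit V x0 = {y}) \<or> infinite (omega_limit V x0)) \<and>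
    ((\<exists>y. omega_limit_weak V x0 = {y}) \<or> infinite (omega_limit_weak V x0))"
    using omega_limit_weak_singleton_or_infinite omega_limit_eq_weak by metis
qed

end
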